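(* Let $r\in\mathbb{N}$, let $a_1\in\mathbb{N}$ and $a_j\in\mathbb{N}_0$ for $2\le j\le r$, and put $\mathbf{s}=(\{2\}^{a_1},1,\{2\}^{a_2},1,\dots,\{2\}^{a_r},1)$. Then for every $n\in\mathbb{N}$, \[ H^\star_n(\mathbf{s})=\sum_{\mathbf{p}\in\Pi(2a_1+1,\,2a_2+1,\,\dots,\,2a_r+1)}2^{\ell(\mathbf{p})}\,\mathcal{H}_n(\mathbf{p}). \]
   Context: $\mathbb{N}=\{1,2,\dots\}$, $\mathbb{N}_0=\mathbb{N}\cup\{0\}$. For $\mathbf{s}=(s_1,\dots,s_\ell)$ with nonzero integer entries, $H_n(\mathbf{s})=\sum_{n\ge k_1>\cdots>k_\ell\ge1}\prod_{i=1}^\ell \frac{\operatorname{sgn}(s_i)^{k_i}}{k_i^{|s_i|}}$ and $H^\star_n(\mathbf{s})=\sum_{n\ge k_1\ge\cdots\ge k_\ell\ge1}\prod_{i=1}^\ell \frac{\operatorname{sgn}(s_i)^{k_i}}{k_i^{|s_i|}}$, with $H_n(\mathbf{s})=0$ if $n<\ell$ and $H_n(\emptyset)=H^\star_n(\emptyset)=1$ for $n\ge0$. $\{2\}^a$ denotes $a$ copies of $2$. For nonzero integers $a,b$, $a\oplus b=\operatorname{sgn}(a)b+\operatorname{sgn}(b)a$. For a sequence $(s_1,\dots,s_m)$ of nonzero integers, $\Pi(s_1,\dots,s_m)$ is the set of the $2^{m-1}$ indices $s_1\circ\cdots\circ s_m$ where each $\circ$ is independently either "," or $\oplus$ (entries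 joined by $\oplus$ merge into one component); $\ell(\mathbf{p})$ is the number of components of $\mathbf{p}$. For $\mathbf{p}=(p_1,\dots,p_m)$ of nonzero integers, \[\mathcal{H}_n(\mathbf{p})=\sum_{k=1}^n\frac{\operatorname{sgn}(p_1)^k}{k^{|p_1|}}\cdot\frac{\binom{n}{k}}{\binom{n+k}{k}}\cdot H_{k-1}(p_2,\dots,p_m).\] *)

theory Defs
  imports Complex_Main
begin

text \<open>
  An index \<open>(s\<^sub>1, \<dots>, s\<^sub>l)\<close> of nonzero integers is an \<open>int list\<close>; a summation tuple
  \<open>(k\<^sub>1, \<dots>, k\<^sub>l)\<close> is a \<open>nat list\<close> of the same length.
\<close>

definition signed_recip_power :: "int \<Rightarrow> nat \<Rightarrow> real" where
  "signed_recip_power s k = of_int (sgn s) ^ k / real k ^ nat \<bar>s\<bar>"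

definition harmonic_sum :: "nat \<Rightarrow> int list \<Rightarrow> real" where
  "harmonic_sum n s =
     (\<Sum>k | length k = length s \<and> sorted_wrt (>) k \<and> set k \<subseteq> {1..n}.
        \<Prod>i<length s. signed_recip_power (s ! i) (k ! i))"

definition harmonic_star_sum :: "nat \<Rightarrow> int list \<Rightarrow> real" where
  "harmonic_star_sum n s =
     (\<Sum>k | length k = length s \<and> sorted_wrt (\<ge>) k \<and> set k \<subseteq> {1..n}.
        \<Prod>i<length s. signed_recip_power (s ! i) (k ! i))"

definition oplus :: "int \<Rightarrow> int \<Rightarrow> int" where
  "oplus a b = sgn a * b + sgn b * a"

text \<open>
  The set \<open>\<Pi>(s\<^sub>1, \<dots>, s\<^sub>m)\<close> of the indices \<open>s\<^sub>1 \<circ> \<dots> \<circ> s\<^sub>m\<close>: the first \<open>\<circ>\<close> is either a comma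
  or \<open>\<oplus>\<close>, and the remaining ones are chosen recursively. It is only meant for \<open>m \<ge> 1\<close>.
\<close>

fun index_merges :: "int list \<Rightarrow> int list set" where
  "index_merges [] = {}"
| "index_merges [s] = {[s]}"
| "index_merges (s # t # ss) =
     (\<lambda>p. s # p) ` index_merges (t # ss) \<union> index_merges (oplus s t # ss)"

text \<open>The value at the empty index is a dummy; the sum is only meant for nonempty indices.\<close>

fun binomial_harmonic_sum :: "nat \<Rightarrow> int list \<Rightarrow> real" where
  "binomial_harmonic_sum n [] = 0"
| "binomial_harmonic_sum n (p # ps) =
     (\<Sum>k=1..n. signed_recip_power p k
        * (real (n choose k) / real ((n + k) choose k))
        * harmonic_sum (k - 1) ps)"

end

(*
  Write w n k = (n choose k) / (n + k choose k). Since
  w n k - w (n - 1) k = w n k * k^2 / n^2, prepending a 2 to an index on the left-hand side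
  amounts to dividing the coefficient function g in the expansion "sum over k of w n k * g k"
  by k^2. Since (n - j) w n j = 2 * (sum over k > j of k * w n k), prepending a 1 amounts to
  replacing g k by (g k + 2 * (sum over j < k of g j)) / k. Starting from g = (indicator of 0)
  for the empty index, this produces the sum over k_1 >= ... >= k_r of the product of the
  k_i^(-2 a_i - 1), weighted by 2^(number of distinct k_i); grouping the summation tuples by
  their coincidences gives the sum over merged indices.
*)
theory Submission
  imports Defs
begin

section \<open>Recursion of nested sums on the outermost variable\<close>

lemma finite_bounded_lists: "finite {k. length k = l \<and> Q k \<and> set k \<subseteq> {1..n::nat}}"
  by (rule finite_subset[OF _ finite_lists_length_eq[of "{1..n}" l]]) auto

text \<open>Splits off the first entry \<open>x\<close> of the tuple. Comparing the other entries
  with \<open>x\<close> amounts to the upper bound \<open>b x\<close>, which is \<open>x - 1\<close>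
  for the strict sums and \<open>x\<close> for the star sums.\<close>

lemma sum_lists_Cons:
  fixes f :: "int \<Rightarrow> nat \<Rightarrow> real"
  assumes "\<And>x y. x \<in> {1..n} \<Longrightarrow> y \<in> {1..n} \<and> P x y \<longleftrightarrow> y \<in> {1..b x}"
  shows "(\<Sum>k | length k = length (s # ss) \<and> sorted_wrt P k \<and> set k \<subseteq> {1..n}.
            \<Prod>i<length (s # ss). f ((s # ss) ! i) (k ! i))
       = (\<Sum>x=1..n. f s x * (\<Sum>k | length k = length ss \<and> sorted_wrt P k \<and> set k \<subseteq> {1..b x}.
            \<Prod>i<length ss. f (ss ! i) (k ! i)))"
    (is "sum ?F ?A = _")
proof -
  let ?B = "\<lambda>x. {k. length k = length ss \<and> sorted_wrt P k \<and> set k \<subseteq> {1..b x}}"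
  have A: "?A = (\<lambda>(x, k). x # k) ` (SIGMA x:{1..n}. ?B x)" (is "_ = ?R")
  proof (intro set_eqI iffI)
    fix k assume "k \<in> ?A"
    then obtain x ks where k: "k = x # ks" and l: "length ks = length ss" "x \<in> {1..n}"
      "set ks \<subseteq> {1..n}" "\<forall>y\<in>set ks. P x y" "sorted_wrt P ks"
      by (cases k) auto
    have "set ks \<subseteq> {1..b x}" using l(3,4) assms[OF l(2)] by blast
    with k l show "k \<in> ?R" by auto
  next
    fix k assume "k \<in> ?R"
    then obtain x ks where k: "k = x # ks" and l: "length ks = length ss" "x \<in> {1..n}"
      "set ks \<subseteq> {1..b x}" "sorted_wrt P ks"
      by auto
    have "set ks \<subseteq> {1..n}" "\<forall>y\<in>set ks. P x y" using l(3) assms[OF l(2)] by blast+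
    with k l show "k \<in> ?A" by auto
  qed
  have "sum ?F ?A = (\<Sum>(x, k)\<in>(SIGMA x:{1..n}. ?B x). ?F (x # k))"
    unfolding A by (subst sum.reindex) (auto simp: inj_on_def case_prod_unfold)
  also have "\<dots> = (\<Sum>x=1..n. \<Sum>k\<in>?B x. ?F (x # k))"
    by (subst sum.Sigma) (auto intro: finite_bounded_lists simp del: One_nat_def)
  also have "\<dots> = (\<Sum>x=1..n. f s x * (\<Sum>k\<in>?B x. \<Prod>i<length ss. f (ss ! i) (k ! i)))"
    by (simp add: prod.lessThan_Suc_shift sum_distrib_left del: prod.lessThan_Suc)
  finally show ?thesis .
qed

lemma harmonic_sum_Nil: "harmonic_sum n [] = 1"
proof -
  have "{k. length k = length ([] :: int list) \<and> sorted_wrt (>) k \<and> set k \<subseteq> {1..n}} = {[]}"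
    by auto
  then show ?thesis by (simp add: harmonic_sum_def cong: conj_cong)
qed

lemma harmonic_star_sum_Nil: "harmonic_star_sum n [] = 1"
proof -
  have "{k. length k = length ([] :: int list) \<and> sorted_wrt (\<ge>) k \<and> set k \<subseteq> {1..n}} = {[]}"
    by auto
  then show ?thesis by (simp add: harmonic_star_sum_def cong: conj_cong)
qed

lemma harmonic_sum_Cons:
  "harmonic_sum n (s # ss) = (\<Sum>k=1..n. signed_recip_power s k * harmonic_sum (k - 1) ss)"
  unfolding harmonic_sum_def by (rule sum_lists_Cons) auto

lemma harmonic_star_sum_Cons:
  "harmonic_star_sum n (s # ss) = (\<Sum>k=1..n. signed_recip_power s k * harmonic_star_sum k ss)"
  unfolding harmonic_star_sum_def by (rule sum_lists_Cons) auto

section \<open>Identities for the binomial weights\<close>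

definition binomial_weight :: "nat \<Rightarrow> nat \<Rightarrow> real" where
  "binomial_weight n k = real (n choose k) / real ((n + k) choose k)"

lemma binomial_weight_0 [simp]: "binomial_weight n 0 = 1"
  by (simp add: binomial_weight_def)

lemma binomial_weight_eq_0 [simp]: "n < k \<Longrightarrow> binomial_weight n k = 0"
  by (simp add: binomial_weight_def)

text \<open>This is n!^2 / ((n - k)! (n + k)!) for n = k + d, a form that avoids truncated
  subtraction.\<close>

lemma binomial_weight_fact:
  "binomial_weight (k + d) k = fact (k + d) ^ 2 / (fact d * fact (2 * k + d))"
proof -
  have eq: "k + d + k = 2 * k + d" by simp
  show ?thesis unfolding binomial_weight_def eq by (simp add: binomial_fact power2_eq_square)
qed

lemma binomial_weight_diff:
  "binomial_weight (Suc n) k - binomial_weight n k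
     = binomial_weight (Suc n) k * real k ^ 2 / real (Suc n) ^ 2"
proof (cases "k \<le> n")
  case True
  then obtain d where n: "n = k + d" using le_Suc_ex by blast
  define F where "F = (fact n ^ 2 / (fact d * fact (2 * k + d)) :: real)"
  have 1: "binomial_weight n k = F"
    unfolding n F_def by (rule binomial_weight_fact)
  have "binomial_weight (Suc n) k = fact (Suc n) ^ 2 / (fact (Suc d) * fact (Suc (2 * k + d)))"
    using binomial_weight_fact[of k "Suc d"] by (simp add: n)
  also have "\<dots> = real (Suc n) ^ 2 / (real (Suc d) * real (Suc (2 * k + d))) * F"
    unfolding F_def fact_Suc power_mult_distrib of_nat_mult times_divide_times_eq
    by (simp only: ac_simps)
  finally have 2: "binomial_weight (Suc n) k * (real (Suc d) * real (Suc (2 * k + d)))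
      = real (Suc n) ^ 2 * F"
    by (simp del: of_nat_Suc)
  \<comment> \<open>The two factors are n + 1 - k and n + 1 + k.\<close>
  have "real (Suc n) ^ 2 - real k ^ 2 = real (Suc d) * real (Suc (2 * k + d))"
    by (simp add: n algebra_simps power2_eq_square)
  with 2 have "binomial_weight (Suc n) k * (real (Suc n) ^ 2 - real k ^ 2) = real (Suc n) ^ 2 * F"
    by simp
  then show ?thesis unfolding 1 by (simp add: field_simps del: of_nat_Suc)
next
  case False
  \<comment> \<open>For k = n + 1 the weight at \<open>n\<close> is 0 and the quotient of squares is
    1; for larger \<open>k\<close> both weights vanish.\<close>
  then consider "k = Suc n" | "Suc n < k" by linarith
  then show ?thesis by cases (simp_all del: of_nat_Suc)
qed

lemma binomial_weight_Suc_right: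
  assumes "k < n"
  shows "real (n - k) * binomial_weight n k = real (n + Suc k) * binomial_weight n (Suc k)"
proof -
  from assms obtain d where n: "n = Suc k + d" using less_iff_Suc_add by auto
  have nd: "n = k + Suc d" using n by simp
  define A B :: real where "A = fact d" and "B = fact (Suc (2 * k + d))"
  have AB: "A \<noteq> 0" "B \<noteq> 0" by (simp_all add: A_def B_def)
  have 1: "binomial_weight n k = fact n ^ 2 / (real (Suc d) * A * B)"
    unfolding nd binomial_weight_fact by (simp add: A_def B_def)
  have "2 * Suc k + d = Suc (Suc (2 * k + d))" "n + Suc k = Suc (Suc (2 * k + d))"
    using n by simp_all
  then have 2: "binomial_weight n (Suc k) = fact n ^ 2 / (A * (real (n + Suc k) * B))"
    unfolding n binomial_weight_fact A_def B_def by (simp only: fact_Suc of_nat_mult n)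
  have "n - k = Suc d" using n by simp
  then show ?thesis unfolding 1 2 using AB by (simp del: of_nat_Suc of_nat_add)
qed

text \<open>Telescopes downwards from j = n, because n + j + 1 = 2 (j + 1) + (n - (j + 1)).\<close>

lemma binomial_weight_tail_sum:
  assumes "j \<le> n"
  shows "(real n - real j) * binomial_weight n j = 2 * (\<Sum>k=Suc j..n. real k * binomial_weight n k)"
  using assms
proof (induction j rule: inc_induct)
  case base
  show ?case by simp
next
  case (step j)
  have "(real n - real j) * binomial_weight n j = real (n + Suc j) * binomial_weight n (Suc j)"
    using binomial_weight_Suc_right[of j n] step.hyps by (simp add: of_nat_diff)
  also have "\<dots> = 2 * (real (Suc j) * binomial_weight n (Suc j))
      + (real n - real (Suc j)) * binomial_weight n (Suc j)"
    by (simp add: algebra_simps)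
  also have "\<dots> = 2 * (\<Sum>k=Suc j..n. real k * binomial_weight n k)"
    using step by (simp add: sum.atLeast_Suc_atMost[of "Suc j" n] del: of_nat_Suc)
  finally show ?case .
qed

section \<open>Sums against the binomial weights\<close>

definition weight_sum :: "(nat \<Rightarrow> real) \<Rightarrow> nat \<Rightarrow> real" where
  "weight_sum g n = (\<Sum>k\<le>n. binomial_weight n k * g k)"

lemma weight_sum_diff:
  "weight_sum g (Suc n) - weight_sum g n = weight_sum (\<lambda>k. real k ^ 2 * g k) (Suc n) / real (Suc n) ^ 2"
proof -
  \<comment> \<open>The added term at \<open>Suc n\<close> has weight 0, so both sums run over the
    same range.\<close>
  have "weight_sum g n = (\<Sum>k\<le>Suc n. binomial_weight n k * g k)"
    by (simp add: weight_sum_def)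
  then have "weight_sum g (Suc n) - weight_sum g n
      = (\<Sum>k\<le>Suc n. (binomial_weight (Suc n) k - binomial_weight n k) * g k)"
    unfolding weight_sum_def by (simp only: sum_subtractf left_diff_distrib)
  also have "\<dots> = weight_sum (\<lambda>k. real k ^ 2 * g k) (Suc n) / real (Suc n) ^ 2"
    unfolding binomial_weight_diff weight_sum_def sum_divide_distrib
    by (intro sum.cong) (simp_all del: of_nat_Suc)
  finally show ?thesis .
qed

text \<open>Split n = j + (n - j) in the coefficient of \<open>g j\<close>. The tail-sum identity
  expands the second part, and interchanging the summations collects what belongs to each
  weight.\<close>

lemma weight_sum_mult:
  "real n * weight_sum g n = weight_sum (\<lambda>k. real k * (g k + 2 * (\<Sum>j<k. g j))) n"
proof -
  let ?w = "binomial_weight n"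
  have "(\<Sum>k\<le>n. \<Sum>j<k. real k * ?w k * g j) = (\<Sum>j\<le>n. \<Sum>k=Suc j..n. real k * ?w k * g j)"
  proof -
    have "(\<Sum>k\<le>n. \<Sum>j<k. real k * ?w k * g j)
        = (\<Sum>(k, j)\<in>(SIGMA k:{..n}. {..<k}). real k * ?w k * g j)"
      by (simp add: sum.Sigma)
    also have "\<dots> = (\<Sum>(j, k)\<in>(SIGMA j:{..n}. {Suc j..n}). real k * ?w k * g j)"
      by (rule sum.reindex_bij_witness[where i = prod.swap and j = prod.swap]) auto
    also have "\<dots> = (\<Sum>j\<le>n. \<Sum>k=Suc j..n. real k * ?w k * g j)"
      by (simp add: sum.Sigma)
    finally show ?thesis .
  qed
  then have "2 * (\<Sum>k\<le>n. \<Sum>j<k. real k * ?w k * g j)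
      = (\<Sum>j\<le>n. 2 * (\<Sum>k=Suc j..n. real k * ?w k) * g j)"
    by (simp add: sum_distrib_left sum_distrib_right mult.assoc)
  also have "\<dots> = (\<Sum>j\<le>n. (real n - real j) * ?w j * g j)"
    by (intro sum.cong) (simp_all add: binomial_weight_tail_sum)
  finally have "real n * weight_sum g n
      = (\<Sum>k\<le>n. real k * ?w k * g k) + 2 * (\<Sum>k\<le>n. \<Sum>j<k. real k * ?w k * g j)"
    by (simp add: weight_sum_def sum_distrib_left algebra_simps flip: sum.distrib)
  then show ?thesis
    by (simp add: weight_sum_def sum_distrib_left algebra_simps flip: sum.distrib)
qed

text \<open>Both sides have the same increments in \<open>n\<close>, and at n = 0 the right-hand
  side is \<open>h 0\<close>.\<close>

lemma weight_sum_eq_partial_sum: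
  assumes "h 0 = 0"
    and "\<And>n. n \<ge> 1 \<Longrightarrow> f n = weight_sum (\<lambda>k. real k ^ 2 * h k) n / real n ^ 2"
  shows "(\<Sum>k=1..n. f k) = weight_sum h n"
proof (induction n)
  case 0
  then show ?case using assms(1) by (simp add: weight_sum_def)
next
  case (Suc n)
  then show ?case using weight_sum_diff[of h n] assms(2)[of "Suc n"] by simp
qed

section \<open>Prepending entries to the star index\<close>

text \<open>The coefficients for \<open>t\<close> carry a factor \<open>k\<close> so that they
  vanish at 0; otherwise dividing by \<open>k ^ 2\<close> and multiplying back would lose the value
  there.\<close>

lemma harmonic_star_sum_Cons_2:
  assumes "\<And>n. harmonic_star_sum n t = weight_sum (\<lambda>k. real k * g k) n"
  shows "harmonic_star_sum n (2 # t) = weight_sum (\<lambda>k. g k / real k) n"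
  unfolding harmonic_star_sum_Cons
proof (rule weight_sum_eq_partial_sum)
  fix n :: nat
  have "(\<lambda>k. real k ^ 2 * (g k / real k)) = (\<lambda>k. real k * g k)"
    by (auto simp: power2_eq_square)
  then show "signed_recip_power 2 n * harmonic_star_sum n t
      = weight_sum (\<lambda>k. real k ^ 2 * (g k / real k)) n / real n ^ 2"
    by (simp add: assms signed_recip_power_def)
qed simp

text \<open>As 1 / n = n / n^2, the formula for \<open>real n * weight_sum g n\<close> applies. Here
  \<open>g 0\<close> may be nonzero, so the empty index can serve as the start.\<close>

lemma harmonic_star_sum_Cons_1:
  assumes "\<And>n. harmonic_star_sum n t = weight_sum g n"
  shows "harmonic_star_sum n (1 # t) = weight_sum (\<lambda>k. (g k + 2 * (\<Sum>j<k. g j)) / real k) n"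
  unfolding harmonic_star_sum_Cons
proof (rule weight_sum_eq_partial_sum)
  fix n :: nat assume n: "n \<ge> 1"
  have "(\<lambda>k. real k ^ 2 * ((g k + 2 * (\<Sum>j<k. g j)) / real k))
      = (\<lambda>k. real k * (g k + 2 * (\<Sum>j<k. g j)))"
    by (auto simp: power2_eq_square)
  then show "signed_recip_power 1 n * harmonic_star_sum n t
      = weight_sum (\<lambda>k. real k ^ 2 * ((g k + 2 * (\<Sum>j<k. g j)) / real k)) n / real n ^ 2"
    using n weight_sum_mult[of n g, symmetric]
    by (simp add: assms signed_recip_power_def power2_eq_square)
qed simp

text \<open>
  The part with \<open>k\<^sub>1 = k\<close> of the sum of \<open>2\<^bsup>d\<^esup> \<Prod>i. sgn(s\<^sub>i)\<^bsup>k\<^sub>i\<^esup> / k\<^sub>i\<^bsup>|s\<^sub>i|\<^esup>\<close> over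
  \<open>k\<^sub>1 \<ge> \<dots> \<ge> k\<^sub>l \<ge> 1\<close>, where \<open>d\<close> is the number of distinct \<open>k\<^sub>i\<close>. The empty index acts as a
  final entry \<open>k\<^bsub>l+1\<^esub> = 0\<close>; for a nonempty index the value at \<open>0\<close> is \<open>0\<close>, by division by zero.
\<close>

fun merged_term :: "int list \<Rightarrow> nat \<Rightarrow> real" where
  "merged_term [] k = (if k = 0 then 1 else 0)"
| "merged_term (s # ss) k =
     signed_recip_power s k * (merged_term ss k + 2 * (\<Sum>j<k. merged_term ss j))"

lemma signed_recip_power_0: "s \<noteq> 0 \<Longrightarrow> signed_recip_power s 0 = 0"
  by (simp add: signed_recip_power_def)

lemma harmonic_star_sum_block:
  assumes "\<And>n. harmonic_star_sum n t = weight_sum (merged_term es) n"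
  shows "harmonic_star_sum n (replicate a 2 @ 1 # t)
    = weight_sum (merged_term ((2 * int a + 1) # es)) n"
proof -
  define g where "g k = merged_term es k + 2 * (\<Sum>j<k. merged_term es j)" for k
  have "harmonic_star_sum n (replicate a 2 @ 1 # t) = weight_sum (\<lambda>k. g k / real k ^ (2 * a + 1)) n"
  proof (induction a arbitrary: n)
    case 0
    show ?case using harmonic_star_sum_Cons_1[OF assms] by (simp add: g_def)
  next
    case (Suc a)
    \<comment> \<open>The exponents are positive, so at k = 0 both sides are 0.\<close>
    have "(\<lambda>k. g k / real k ^ (2 * a + 1)) = (\<lambda>k. real k * (g k / real k ^ (2 * a + 2)))"
      by (auto simp: fun_eq_iff)
    then show ?case
      using harmonic_star_sum_Cons_2[of "replicate a 2 @ 1 # t" "\<lambda>k. g k / real k ^ (2 * a + 2)"] Suc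
      by (simp add: mult.commute)
  qed
  moreover have "nat \<bar>2 * int a + 1\<bar> = 2 * a + 1" by simp
  then have "merged_term ((2 * int a + 1) # es) = (\<lambda>k. g k / real k ^ (2 * a + 1))"
    by (simp add: fun_eq_iff g_def signed_recip_power_def sgn_if del: power_Suc)
  ultimately show ?thesis by simp
qed

lemma harmonic_star_sum_blocks:
  "harmonic_star_sum n (concat (map (\<lambda>a. replicate a 2 @ [1]) as))
    = weight_sum (merged_term (map (\<lambda>a. 2 * int a + 1) as)) n"
proof (induction as arbitrary: n)
  case Nil
  have "weight_sum (merged_term []) n = (\<Sum>k\<le>n. if k = 0 then 1 else 0)"
    unfolding weight_sum_def by (intro sum.cong) auto
  then show ?case by (simp add: harmonic_star_sum_Nil del: merged_term.simps)
next
  case (Cons a as)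
  then show ?case using harmonic_star_sum_block by (simp del: merged_term.simps)
qed

section \<open>Sums over merged indices\<close>

lemma abs_oplus: "a \<noteq> 0 \<Longrightarrow> b \<noteq> 0 \<Longrightarrow> \<bar>oplus a b\<bar> = \<bar>a\<bar> + \<bar>b\<bar>"
  by (auto simp: oplus_def sgn_if)

lemma sgn_oplus: "a \<noteq> 0 \<Longrightarrow> b \<noteq> 0 \<Longrightarrow> sgn (oplus a b) = sgn a * sgn b"
  by (auto simp: oplus_def sgn_if)

lemma oplus_nonzero: "a \<noteq> 0 \<Longrightarrow> b \<noteq> 0 \<Longrightarrow> oplus a b \<noteq> 0"
  using abs_oplus[of a b] by linarith

lemma signed_recip_power_oplus:
  assumes "a \<noteq> 0" "b \<noteq> 0"
  shows "signed_recip_power (oplus a b) k = signed_recip_power a k * signed_recip_power b k"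
  using assms
  by (simp add: signed_recip_power_def abs_oplus sgn_oplus nat_add_distrib power_add power_mult_distrib)

lemma finite_index_merges [simp]: "finite (index_merges es)"
  by (induction es rule: index_merges.induct) auto

text \<open>Each merge adds absolute values, so the first entry can only grow.\<close>

lemma index_merges_hd:
  assumes "p \<in> index_merges (s # ss)" "0 \<notin> set (s # ss)"
  shows "p \<noteq> [] \<and> \<bar>s\<bar> \<le> \<bar>hd p\<bar>"
  using assms
proof (induction "s # ss" arbitrary: s ss p rule: index_merges.induct)
  case (3 s t ss)
  then have "0 \<notin> set (oplus s t # ss)" "\<bar>s\<bar> \<le> \<bar>oplus s t\<bar>"
    using oplus_nonzero[of s t] abs_oplus[of s t] by auto
  with 3 show ?case by fastforce
qed auto

text \<open>A comma keeps the first entry \<open>s\<close>, whereas a merge raises its absolute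
  value above that of \<open>s\<close>. Hence a sum over the set splits by the first choice.\<close>

lemma index_merges_disjoint:
  assumes "0 \<notin> set (s # t # ss)"
  shows "(#) s ` index_merges (t # ss) \<inter> index_merges (oplus s t # ss) = {}"
proof -
  have "0 \<notin> set (oplus s t # ss)" "\<bar>s\<bar> < \<bar>oplus s t\<bar>"
    using assms oplus_nonzero[of s t] abs_oplus[of s t] by auto
  then show ?thesis using index_merges_hd[of _ "oplus s t" ss] by fastforce
qed

text \<open>The summand with first variable \<open>k\<close> that \<open>harmonic_sum\<close> and,
  up to the weight, \<open>binomial_harmonic_sum\<close> have in common.\<close>

fun leading_term :: "int list \<Rightarrow> nat \<Rightarrow> real" where
  "leading_term [] k = 0"
| "leading_term (p # ps) k = signed_recip_power p k * harmonic_sum (k - 1) ps"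

lemma harmonic_sum_leading_term:
  "p \<noteq> [] \<Longrightarrow> harmonic_sum n p = (\<Sum>k=1..n. leading_term p k)"
  by (cases p) (simp_all add: harmonic_sum_Cons)

lemma binomial_harmonic_sum_leading_term:
  "binomial_harmonic_sum n p = (\<Sum>k=1..n. binomial_weight n k * leading_term p k)"
  by (cases p) (simp_all add: binomial_weight_def ac_simps)

text \<open>A comma after the first entry stands for a strict drop to the next variable, hence one
  more distinct value and a factor 2; a merge stands for equality of the two variables.\<close>

lemma sum_index_merges_leading_term:
  assumes "es \<noteq> []" "0 \<notin> set es" "k \<ge> 1"
  shows "(\<Sum>p\<in>index_merges es. 2 ^ length p * leading_term p k) = merged_term es k"
  using assms
proof (induction es arbitrary: k rule: index_merges.induct)
  case (2 s)
  \<comment> \<open>As \<open>k \<ge> 1\<close>, the range contains 0, where the empty index has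
    value 1; this yields the factor 2 of a single entry.\<close>
  then have "(\<Sum>j<k. merged_term [] j) = 1" by simp
  with 2 show ?case by (simp add: harmonic_sum_Nil)
next
  case (3 s t ss)
  let ?M = "index_merges (t # ss)"
  have nz: "0 \<notin> set (t # ss)" "s \<noteq> 0" "t \<noteq> 0" "0 \<notin> set (oplus s t # ss)"
    using 3 oplus_nonzero[of s t] by auto
  have "(\<Sum>p\<in>(#) s ` ?M. 2 ^ length p * leading_term p k)
      = (\<Sum>p\<in>?M. 2 * signed_recip_power s k * (2 ^ length p * harmonic_sum (k - 1) p))"
    by (subst sum.reindex) (simp_all add: ac_simps)
  also have "\<dots> = (\<Sum>p\<in>?M. 2 * signed_recip_power s k * (\<Sum>j=1..k-1. 2 ^ length p * leading_term p j))"
    using index_merges_hd[OF _ nz(1)]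
    by (intro sum.cong) (auto simp: harmonic_sum_leading_term sum_distrib_left)
  also have "\<dots> = 2 * signed_recip_power s k * (\<Sum>j=1..k-1. \<Sum>p\<in>?M. 2 ^ length p * leading_term p j)"
    by (subst sum.swap) (simp only: sum_distrib_left)
  also have "(\<Sum>j=1..k-1. \<Sum>p\<in>?M. 2 ^ length p * leading_term p j) = (\<Sum>j=1..k-1. merged_term (t # ss) j)"
    using 3 nz by (intro sum.cong) auto
  \<comment> \<open>The term at j = 0 vanishes because \<open>t\<close> is nonzero.\<close>
  also have "\<dots> = (\<Sum>j<k. merged_term (t # ss) j)"
    using nz(3) by (intro sum.mono_neutral_left) (auto simp: signed_recip_power_0 Suc_le_eq not_less)
  finally have 1: "(\<Sum>p\<in>(#) s ` ?M. 2 ^ length p * leading_term p k)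
      = 2 * signed_recip_power s k * (\<Sum>j<k. merged_term (t # ss) j)" .
  \<comment> \<open>In the induction hypothesis for the merged index, the factor of
    \<open>oplus s t\<close> splits into those of \<open>s\<close> and \<open>t\<close>.\<close>
  have 2: "(\<Sum>p\<in>index_merges (oplus s t # ss). 2 ^ length p * leading_term p k)
      = signed_recip_power s k * merged_term (t # ss) k"
    using 3 nz by (simp add: signed_recip_power_oplus)
  have "(\<Sum>p\<in>index_merges (s # t # ss). 2 ^ length p * leading_term p k)
      = (\<Sum>p\<in>(#) s ` ?M. 2 ^ length p * leading_term p k)
        + (\<Sum>p\<in>index_merges (oplus s t # ss). 2 ^ length p * leading_term p k)"
    unfolding index_merges.simps using index_merges_disjoint[OF 3(4)]
    by (intro sum.union_disjoint) auto
  also have "\<dots> = merged_term (s # t # ss) k"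
    unfolding 1 2 merged_term.simps(2)[of s] by (simp only: algebra_simps)
  finally show ?case .
qed simp

lemma sum_index_merges_binomial_harmonic_sum:
  assumes "es \<noteq> []" "0 \<notin> set es"
  shows "(\<Sum>p\<in>index_merges es. 2 ^ length p * binomial_harmonic_sum n p) = weight_sum (merged_term es) n"
proof -
  have "(\<Sum>p\<in>index_merges es. 2 ^ length p * binomial_harmonic_sum n p)
      = (\<Sum>p\<in>index_merges es. \<Sum>k=1..n. binomial_weight n k * (2 ^ length p * leading_term p k))"
    by (simp add: binomial_harmonic_sum_leading_term sum_distrib_left ac_simps)
  also have "\<dots> = (\<Sum>k=1..n. binomial_weight n k * (\<Sum>p\<in>index_merges es. 2 ^ length p * leading_term p k))"
    by (subst sum.swap) (simp only: sum_distrib_left)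
  also have "\<dots> = (\<Sum>k=1..n. binomial_weight n k * merged_term es k)"
    using assms by (intro sum.cong) (auto simp: sum_index_merges_leading_term)
  \<comment> \<open>Including k = 0 adds 0, since \<open>es\<close> is nonempty with nonzero
    entries.\<close>
  also have "\<dots> = weight_sum (merged_term es) n"
    unfolding weight_sum_def using assms
    by (intro sum.mono_neutral_left) (cases es; auto simp: signed_recip_power_0 Suc_le_eq)+
  finally show ?thesis .
qed

theorem theorem2p1:
  fixes r n :: nat and a :: "nat \<Rightarrow> nat" and s :: "int list"
  assumes "r \<ge> 1" and "a 1 \<ge> 1" and "n \<ge> 1"
    and "s = concat (map (\<lambda>j. replicate (a j) 2 @ [1]) [1..<r + 1])"
  shows "harmonic_star_sum n s =
    (\<Sum>p\<in>index_merges (map (\<lambda>j. 2 * int (a j) + 1) [1..<r + 1]).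
       2 ^ length p * binomial_harmonic_sum n p)"
proof -
  have "0 \<notin> set (map (\<lambda>j. 2 * int (a j) + 1) [1..<r + 1])"
    by (auto; presburger)
  then have "(\<Sum>p\<in>index_merges (map (\<lambda>j. 2 * int (a j) + 1) [1..<r + 1]).
       2 ^ length p * binomial_harmonic_sum n p)
     = weight_sum (merged_term (map (\<lambda>j. 2 * int (a j) + 1) [1..<r + 1])) n"
    using assms(1) by (intro sum_index_merges_binomial_harmonic_sum) auto
  with harmonic_star_sum_blocks[of n "map a [1..<r + 1]"] show ?thesis
    by (simp add: assms(4) comp_def del: upt_Suc)
qed

end
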